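(* Let $b_1,\dots,b_n \in \mathbb{R}^m$ be an LLL-reduced basis of the lattice $L$, let $1 \le k \le n$, and let $d_1,\dots,d_k$ be arbitrary linearly independent vectors in $L$. Then all of the following hold: $$\|b_1\| \le 2^{(n-k)/2 + (k-1)/4}\, (\det L(d_1,\dots,d_k))^{1/k},$$ $$\det L(b_1,\dots,b_k) \le 2^{k(n-k)/2}\, \det L(d_1,\dots,d_k),$$ $$\det L(b_1,\dots,b_k) \le 2^{k(n-k)/4}\, (\det L)^{k/n},$$ $$\|b_1\| \cdots \|b_k\| \le 2^{k(n-k)/2 + k(k-1)/4}\, \det L(d_1,\dots,d_k),$$ $$\|b_1\| \cdots \|b_k\| \le 2^{k(n-1)/4}\, (\det L)^{k/n}.$$
   Context: Throughout, $\langle\cdot,\cdot\rangle$ is the usual inner product on $\mathbb{R}^m$ and $\|\cdot\|$ the Euclidean norm. For linearly independent vectors $b_1,\dots,b_n\in\mathbb{R}^m$, the lattice they generate is $L(b_1,\dots,b_n)=\{\sum_{i=1}^n \lambda_i b_i : \lambda_i\in\mathbb{Z},\ i=1,\dots,n\}$, and $b_1,\dots,b_n$ is called a basis of it. The determinant of a lattice $L$ with basis matrix $B=[b_1,\dots,b_n]$ (columns $b_i$) is $\det L=\sqrt{\det(B^T B)}$, which does not depend on the choice of basis. The Gram-Schmidt vectors of a basis $b_1,\dots,b_n$ are $b_1^*=b_1$ and $b_i^*=b_i-\sum_{j=1}^{i-1}\mu_{ij}b_j^*$ for $i=2,\dots,n$, where $\mu_{ij}=\langle b_i,b_j^*\rangle/\langle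 b_j^*,b_j^*\rangle$. The basis $b_1,\dots,b_n$ of $L$ is LLL-reduced if $|\mu_{ji}|\le 1/2$ for $j=2,\dots,n$ and $i=1,\dots,j-1$, and $\|b_j^*+\mu_{j,j-1}b_{j-1}^*\|^2\ge \tfrac34\|b_{j-1}^*\|^2$ for $1<j\le n$. *)

theory Defs
  imports "HOL-Analysis.Analysis" "Jordan_Normal_Form.Determinant"
begin

text \<open>A family \<open>b\<^sub>1, \<dots>, b\<^sub>n\<close> of vectors is a function on \<open>nat\<close> of which only the
  values at \<open>1, \<dots>, n\<close> matter.\<close>

definition lin_indep_family :: "nat \<Rightarrow> (nat \<Rightarrow> real ^ 'm) \<Rightarrow> bool" where
  "lin_indep_family n b \<longleftrightarrow> inj_on b {1..n} \<and> independent (b ` {1..n})"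

definition generated_lattice :: "nat \<Rightarrow> (nat \<Rightarrow> real ^ 'm) \<Rightarrow> (real ^ 'm) set" where
  "generated_lattice n b = {(\<Sum>i = 1..n. of_int (c i) *\<^sub>R b i) | c :: nat \<Rightarrow> int. True}"

definition lattice_basis :: "nat \<Rightarrow> (nat \<Rightarrow> real ^ 'm) \<Rightarrow> (real ^ 'm) set \<Rightarrow> bool" where
  "lattice_basis n b L \<longleftrightarrow> lin_indep_family n b \<and> L = generated_lattice n b"

text \<open>The matrix \<open>B\<^sup>T B\<close>, where \<open>B\<close> has the columns \<open>b\<^sub>1, \<dots>, b\<^sub>n\<close>: its entries are the inner
  products of these columns. Matrices with a variable number \<open>n\<close> of rows are indexed from \<open>0\<close>,
  hence the shift.\<close>

definition gram_matrix :: "nat \<Rightarrow> (nat \<Rightarrow> real ^ 'm) \<Rightarrow> real Matrix.mat" where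
  "gram_matrix n b = Matrix.mat n n (\<lambda>(i, j). inner (b (Suc i)) (b (Suc j)))"

text \<open>The determinant depends on the lattice as a set only: every basis of it yields the same
  value. The description is meaningful for sets that do have a lattice basis.\<close>

definition lattice_det :: "(real ^ 'm) set \<Rightarrow> real" where
  "lattice_det L =
    (THE D. \<exists>n b. lattice_basis n b L \<and> D = sqrt (Determinant.det (gram_matrix n b)))"

fun gs_vec :: "(nat \<Rightarrow> real ^ 'm) \<Rightarrow> nat \<Rightarrow> real ^ 'm" where
  "gs_vec b i = b i - (\<Sum>j = 1..<i.
     (inner (b i) (gs_vec b j) / inner (gs_vec b j) (gs_vec b j)) *\<^sub>R gs_vec b j)"

declare gs_vec.simps [simp del]

definition gs_coeff :: "(nat \<Rightarrow> real ^ 'm) \<Rightarrow> nat \<Rightarrow> nat \<Rightarrow> real" where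
  "gs_coeff b i j = inner (b i) (gs_vec b j) / inner (gs_vec b j) (gs_vec b j)"

definition LLL_reduced :: "nat \<Rightarrow> (nat \<Rightarrow> real ^ 'm) \<Rightarrow> bool" where
  "LLL_reduced n b \<longleftrightarrow>
     (\<forall>j\<in>{2..n}. \<forall>i\<in>{1..j - 1}. \<bar>gs_coeff b j i\<bar> \<le> 1 / 2) \<and>
     (\<forall>j\<in>{2..n}. (norm (gs_vec b j + gs_coeff b j (j - 1) *\<^sub>R gs_vec b (j - 1)))\<^sup>2
        \<ge> 3 / 4 * (norm (gs_vec b (j - 1)))\<^sup>2)"

end

theory Submission
  imports Defs
begin

text \<open>
  Let \<open>b\<^sub>1\<^sup>*, \<dots>, b\<^sub>n\<^sup>*\<close> be the Gram--Schmidt vectors of the reduced basis. The determinant of a lattice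
  is the product of the Gram--Schmidt norms of any of its bases (\<open>lattice_det_eq_prod_gs\<close>), so all
  the bounds compare products of norms. Two independent facts carry the proof.

  The first holds for every basis: the determinant of a sublattice of rank \<open>k\<close> is at least
  \<open>\<Prod>\<^bsub>i \<in> I\<^esub> \<parallel>b\<^sub>i\<^sup>*\<parallel>\<close> for some set \<open>I\<close> of \<open>k\<close> indices (\<open>exists_gs_vec_prod_le_lattice_det\<close>). Bring the
  coefficient matrix of the sublattice into Hermite normal form, one column at a time. The pivots
  are nonzero integers, and a vector whose last nonzero coefficient is a pivot in column \<open>i\<close> has a
  component of length at least \<open>\<parallel>b\<^sub>i\<^sup>*\<parallel>\<close> orthogonal to \<open>b\<^sub>1, \<dots>, b\<^bsub>i - 1\<^esub>\<close>. The pivot columns form \<open>I\<close>.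

  The second is where reducedness enters: \<open>\<parallel>b\<^sub>i\<^sup>*\<parallel>\<^sup>2 \<le> 2\<^bsup>j - i\<^esup> \<parallel>b\<^sub>j\<^sup>*\<parallel>\<^sup>2\<close> for \<open>i \<le> j\<close>, and
  \<open>\<parallel>b\<^sub>i\<parallel>\<^sup>2 \<le> 2\<^bsup>i - 1\<^esup> \<parallel>b\<^sub>i\<^sup>*\<parallel>\<^sup>2\<close>. With \<open>x\<^sub>i = log\<^sub>2 \<parallel>b\<^sub>i\<^sup>*\<parallel>\<close> the former says that
  \<open>y\<^sub>i = x\<^sub>i + i / 2\<close> is nondecreasing in \<open>i\<close>.

  It remains to sum a nondecreasing sequence. The first \<open>k\<close> terms have a sum at most that over any
  \<open>k\<close> indices, and an average at most that of all \<open>n\<close> terms. Subtracting the sums of \<open>i / 2\<close> again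
  yields the exponents \<open>k(n - k)/2\<close> and \<open>k(n - k)/4\<close>, respectively: these are the bounds on
  \<open>det L(b\<^sub>1, \<dots>, b\<^sub>k)\<close>. Passing from \<open>\<Prod>\<^bsub>i \<le> k\<^esub> \<parallel>b\<^sub>i\<^sup>*\<parallel>\<close> to \<open>\<Prod>\<^bsub>i \<le> k\<^esub> \<parallel>b\<^sub>i\<parallel>\<close>, or to \<open>\<parallel>b\<^sub>1\<parallel>\<^sup>k\<close>, costs a
  further factor \<open>2\<^bsup>k(k - 1)/4\<^esup>\<close>, which gives the other three.
\<close>

section \<open>Lattices and linear independence of families\<close>

lemma generated_latticeI: "(\<Sum>i = 1..n. of_int (c i) *\<^sub>R b i) \<in> generated_lattice n b"
  unfolding generated_lattice_def by blast

lemma generated_latticeE: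
  assumes "x \<in> generated_lattice n b"
  obtains c :: "nat \<Rightarrow> int" where "x = (\<Sum>i = 1..n. of_int (c i) *\<^sub>R b i)"
  using assms unfolding generated_lattice_def by blast

lemma generated_lattice_0: "0 \<in> generated_lattice n b"
  using generated_latticeI[of "\<lambda>_. 0" b n] by simp

lemma generated_lattice_add:
  assumes "x \<in> generated_lattice n b" "y \<in> generated_lattice n b"
  shows "x + y \<in> generated_lattice n b"
proof -
  obtain c where c: "x = (\<Sum>i = 1..n. of_int (c i) *\<^sub>R b i)"
    using assms(1) by (rule generated_latticeE)
  obtain d where d: "y = (\<Sum>i = 1..n. of_int (d i) *\<^sub>R b i)"
    using assms(2) by (rule generated_latticeE)
  have "x + y = (\<Sum>i = 1..n. of_int (c i + d i) *\<^sub>R b i)"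
    unfolding c d by (simp add: sum.distrib algebra_simps)
  then show ?thesis using generated_latticeI by metis
qed

lemma generated_lattice_scale:
  assumes "x \<in> generated_lattice n b"
  shows "of_int a *\<^sub>R x \<in> generated_lattice n b"
proof -
  obtain c where "x = (\<Sum>i = 1..n. of_int (c i) *\<^sub>R b i)"
    using assms by (rule generated_latticeE)
  then have "of_int a *\<^sub>R x = (\<Sum>i = 1..n. of_int (a * c i) *\<^sub>R b i)"
    by (simp add: scaleR_sum_right)
  then show ?thesis using generated_latticeI by metis
qed

lemma generated_lattice_sum:
  assumes "\<And>i. i \<in> A \<Longrightarrow> f i \<in> generated_lattice n b"
  shows "sum f A \<in> generated_lattice n b"
  using assms
  by (induction A rule: infinite_finite_induct) (auto simp: generated_lattice_0 intro: generated_lattice_add)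

lemma generated_lattice_base:
  assumes "i \<in> {1..n}"
  shows "b i \<in> generated_lattice n b"
proof -
  have "(\<Sum>j = 1..n. of_int (if j = i then 1 else 0) *\<^sub>R b j) = (\<Sum>j = 1..n. if j = i then b j else 0)"
    by (rule sum.cong) auto
  also have "\<dots> = b i" using assms by simp
  finally show ?thesis using generated_latticeI by metis
qed

lemma generated_lattice_subset:
  assumes "\<And>i. i \<in> {1..k} \<Longrightarrow> d i \<in> generated_lattice n b"
  shows "generated_lattice k d \<subseteq> generated_lattice n b"
proof
  fix x assume "x \<in> generated_lattice k d"
  then obtain c where c: "x = (\<Sum>i = 1..k. of_int (c i) *\<^sub>R d i)"
    by (rule generated_latticeE)
  show "x \<in> generated_lattice n b"
    unfolding c by (intro generated_lattice_sum generated_lattice_scale assms)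
qed

lemma span_generated_lattice: "span (generated_lattice n b) = span (b ` {1..n})"
proof
  show "span (b ` {1..n}) \<subseteq> span (generated_lattice n b)"
    by (intro span_mono image_subsetI generated_lattice_base)
  have "generated_lattice n b \<subseteq> span (b ` {1..n})"
  proof
    fix x assume "x \<in> generated_lattice n b"
    then obtain c where c: "x = (\<Sum>i = 1..n. of_int (c i) *\<^sub>R b i)"
      by (rule generated_latticeE)
    show "x \<in> span (b ` {1..n})"
      unfolding c by (intro span_sum span_scale span_base imageI)
  qed
  then show "span (generated_lattice n b) \<subseteq> span (b ` {1..n})"
    by (simp add: span_minimal)
qed

lemma dim_generated_lattice:
  assumes "lin_indep_family n b"
  shows "dim (generated_lattice n b) = n"
proof -
  have "dim (generated_lattice n b) = card (b ` {1..n})"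
    using assms by (intro dim_eq_card) (auto simp: span_generated_lattice lin_indep_family_def)
  then show ?thesis using assms by (simp add: lin_indep_family_def card_image)
qed

text \<open>Counting dimensions: \<open>k\<close> vectors that span a space of dimension \<open>k\<close> are independent and
  distinct. Changes of basis therefore preserve independence as soon as they preserve the
  lattice.\<close>

lemma lin_indep_family_cong_lattice:
  assumes "lin_indep_family k d" "generated_lattice k e = generated_lattice k d"
  shows "lin_indep_family k e"
proof -
  have dim: "dim (e ` {1..k}) = k"
    using dim_generated_lattice[OF assms(1)] dim_span[of "e ` {1..k}"] dim_span[of "generated_lattice k e"]
    unfolding span_generated_lattice assms(2)[symmetric] by simp
  have le: "card (e ` {1..k}) \<le> k"
    using card_image_le[of "{1..k}" e] by simp
  have ge: "k \<le> card (e ` {1..k})"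
    using dim_le_card'[of "e ` {1..k}"] dim by simp
  have "independent (e ` {1..k})"
    by (rule card_le_dim_spanning[of _ "e ` {1..k}"]) (use le dim in \<open>simp_all add: span_superset\<close>)
  moreover have "inj_on e {1..k}"
    using le ge by (intro eq_card_imp_inj_on) auto
  ultimately show ?thesis by (simp add: lin_indep_family_def)
qed

lemma lin_indep_family_mono:
  assumes "lin_indep_family n b" "k \<le> n"
  shows "lin_indep_family k b"
proof -
  have "{1..k} \<subseteq> {1..n}" using assms by auto
  then show ?thesis
    using assms(1) inj_on_subset[of b "{1..n}" "{1..k}"]
      independent_mono[of "b ` {1..n}" "b ` {1..k}"]
    unfolding lin_indep_family_def by (simp add: image_mono)
qed

lemma lin_indep_family_notin_span:
  assumes "lin_indep_family n b" "i \<in> {1..n}"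
  shows "b i \<notin> span (b ` {1..<i})"
proof
  assume i: "b i \<in> span (b ` {1..<i})"
  have inj: "inj_on b {1..n}" and ind: "independent (b ` {1..n})"
    using assms(1) unfolding lin_indep_family_def by auto
  have "b ` {1..<i} \<subseteq> b ` {1..n} - {b i}"
  proof
    fix x assume "x \<in> b ` {1..<i}"
    then obtain j where j: "x = b j" "j \<in> {1..<i}" by blast
    then have "j \<in> {1..n}" "j \<noteq> i" using assms(2) by auto
    then show "x \<in> b ` {1..n} - {b i}"
      unfolding j(1) using inj_onD[OF inj, of j i] assms(2) by blast
  qed
  then have "b i \<in> span (b ` {1..n} - {b i})"
    using i span_mono[of "b ` {1..<i}"] by auto
  then have "dependent (b ` {1..n})"
    unfolding dependent_def using assms(2) by (intro bexI[of _ "b i"] imageI)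
  then show False using ind by contradiction
qed

section \<open>Gram determinants and Gram--Schmidt vectors\<close>

lemma gram_matrix_carrier: "gram_matrix n b \<in> carrier_mat n n"
  by (simp add: gram_matrix_def)

lemma det_gram_matrix_transform:
  fixes b e :: "nat \<Rightarrow> real ^ 'm"
  assumes e: "\<And>i. i \<in> {1..n} \<Longrightarrow> e i = (\<Sum>j = 1..n. U i j *\<^sub>R b j)"
  shows "Determinant.det (gram_matrix n e) =
    (Determinant.det (Matrix.mat n n (\<lambda>(i, j). U (Suc i) (Suc j))))\<^sup>2 * Determinant.det (gram_matrix n b)"
proof -
  let ?A = "Matrix.mat n n (\<lambda>(i, j). U (Suc i) (Suc j))"
  let ?G = "gram_matrix n b"
  have A: "?A \<in> carrier_mat n n" by simp
  note G = gram_matrix_carrier[of n b]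
  have eS: "e (Suc i) = (\<Sum>j<n. U (Suc i) (Suc j) *\<^sub>R b (Suc j))" if "i < n" for i
    using e[of "Suc i"] that by (simp add: sum.atLeast1_atMost_eq)
  have "gram_matrix n e = ?A * ?G * transpose_mat ?A"
  proof (rule eq_matI)
    fix i j
    assume "i < dim_row (?A * ?G * transpose_mat ?A)" "j < dim_col (?A * ?G * transpose_mat ?A)"
    then have ij: "i < n" "j < n" by auto
    have "gram_matrix n e $$ (i, j) = inner (e (Suc i)) (e (Suc j))"
      using ij by (simp add: gram_matrix_def)
    also have "\<dots> = (\<Sum>l<n. \<Sum>m<n. U (Suc i) (Suc m) * U (Suc j) (Suc l) * inner (b (Suc m)) (b (Suc l)))"
      using ij by (simp add: eS inner_sum_left inner_sum_right sum_distrib_left mult_ac)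
    also have "\<dots> = (?A * ?G * transpose_mat ?A) $$ (i, j)"
      using ij by (simp add: scalar_prod_def gram_matrix_def sum_distrib_left sum_distrib_right
          lessThan_atLeast0 mult_ac)
    finally show "gram_matrix n e $$ (i, j) = (?A * ?G * transpose_mat ?A) $$ (i, j)" .
  qed (auto simp: gram_matrix_def)
  then have "Determinant.det (gram_matrix n e) =
      Determinant.det ?A * Determinant.det ?G * Determinant.det (transpose_mat ?A)"
    using A G by (simp add: det_mult[of _ n])
  also have "Determinant.det (transpose_mat ?A) = Determinant.det ?A"
    using A by (rule det_transpose)
  finally show ?thesis by (simp add: power2_eq_square)
qed

lemma gs_vec_decomp:
  "b i = gs_vec b i + (\<Sum>j = 1..<i. gs_coeff b i j *\<^sub>R gs_vec b j)"
  by (subst gs_vec.simps) (simp add: gs_coeff_def)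

lemma gs_vec_orthogonal_less:
  "\<forall>i\<in>{1..<j}. inner (gs_vec b i) (gs_vec b j) = 0"
proof (induction j rule: less_induct)
  case (less j)
  show ?case
  proof
    fix i assume i: "i \<in> {1..<j}"
    have orth: "inner (gs_vec b i) (gs_vec b l) = 0" if "l \<in> {1..<j}" "l \<noteq> i" for l
    proof (cases "l < i")
      case True
      then show ?thesis using less[of i] i that by (auto simp: inner_commute[of "gs_vec b i"])
    next
      case False
      then show ?thesis using less[of l] i that by simp
    qed
    have "inner (gs_vec b i) (b j) = inner (gs_vec b i) (gs_vec b j)
        + (\<Sum>l = 1..<j. gs_coeff b j l * inner (gs_vec b i) (gs_vec b l))"
      by (subst gs_vec_decomp[of b j]) (simp add: inner_add_right inner_sum_right)
    also have "(\<Sum>l = 1..<j. gs_coeff b j l * inner (gs_vec b i) (gs_vec b l))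
        = (\<Sum>l = 1..<j. if l = i then gs_coeff b j i * inner (gs_vec b i) (gs_vec b i) else 0)"
      by (rule sum.cong) (auto simp: orth)
    also have "\<dots> = gs_coeff b j i * inner (gs_vec b i) (gs_vec b i)"
      using i by simp
    also have "\<dots> = inner (gs_vec b i) (b j)"
      by (simp add: gs_coeff_def inner_commute)
    finally show "inner (gs_vec b i) (gs_vec b j) = 0" by simp
  qed
qed

lemma gs_vec_orthogonal:
  assumes "1 \<le> i" "1 \<le> j" "i \<noteq> j"
  shows "inner (gs_vec b i) (gs_vec b j) = 0"
  using gs_vec_orthogonal_less[of i b] gs_vec_orthogonal_less[of j b] assms
  by (cases "i < j") (auto simp: inner_commute)

lemma gs_vec_in_span: "1 \<le> i \<Longrightarrow> gs_vec b i \<in> span (b ` {1..i})"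
proof (induction i rule: less_induct)
  case (less i)
  have "gs_vec b j \<in> span (b ` {1..i})" if "j \<in> {1..<i}" for j
  proof -
    have "span (b ` {1..j}) \<subseteq> span (b ` {1..i})"
      using that by (intro span_mono image_mono) auto
    then show ?thesis using less(1)[of j] that by auto
  qed
  then have "(\<Sum>j = 1..<i. gs_coeff b i j *\<^sub>R gs_vec b j) \<in> span (b ` {1..i})"
    by (intro span_sum span_scale) auto
  moreover have "b i \<in> span (b ` {1..i})"
    using less.prems by (intro span_base) auto
  moreover have "gs_vec b i = b i - (\<Sum>j = 1..<i. gs_coeff b i j *\<^sub>R gs_vec b j)"
    using gs_vec_decomp[of b i] by (simp add: eq_diff_eq)
  ultimately show ?case
    by (simp only: span_diff)
qed

lemma gs_vec_in_span_less:
  assumes "j \<in> {1..<i}"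
  shows "gs_vec b j \<in> span (b ` {1..<i})"
proof -
  have "span (b ` {1..j}) \<subseteq> span (b ` {1..<i})"
    using assms by (intro span_mono image_mono) auto
  then show ?thesis using gs_vec_in_span[of j b] assms by auto
qed

lemma gs_vec_nonzero:
  assumes "lin_indep_family n b" "i \<in> {1..n}"
  shows "gs_vec b i \<noteq> 0"
proof
  assume "gs_vec b i = 0"
  then have "b i = (\<Sum>j = 1..<i. gs_coeff b i j *\<^sub>R gs_vec b j)"
    using gs_vec_decomp[of b i] by simp
  moreover have "(\<Sum>j = 1..<i. gs_coeff b i j *\<^sub>R gs_vec b j) \<in> span (b ` {1..<i})"
    by (intro span_sum span_scale gs_vec_in_span_less)
  ultimately have "b i \<in> span (b ` {1..<i})"
    by simp
  then show False using lin_indep_family_notin_span assms by blast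
qed

text \<open>The Gram--Schmidt process is a change of basis by a lower unitriangular matrix, and the
  Gram--Schmidt vectors have a diagonal Gram matrix.\<close>

lemma det_gram_matrix: "Determinant.det (gram_matrix n b) = (\<Prod>i = 1..n. (norm (gs_vec b i))\<^sup>2)"
proof -
  define U where "U i j = (if j < i then gs_coeff b i j else if j = i then 1 else 0)" for i j
  let ?A = "Matrix.mat n n (\<lambda>(i, j). U (Suc i) (Suc j))"
  let ?D = "gram_matrix n (gs_vec b)"
  have "b i = (\<Sum>j = 1..n. U i j *\<^sub>R gs_vec b j)" if i: "i \<in> {1..n}" for i
  proof -
    have "(\<Sum>j = 1..n. U i j *\<^sub>R gs_vec b j) = (\<Sum>j \<in> insert i {1..<i}. U i j *\<^sub>R gs_vec b j)"
      using i by (intro sum.mono_neutral_right) (auto simp: U_def)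
    also have "\<dots> = gs_vec b i + (\<Sum>j = 1..<i. gs_coeff b i j *\<^sub>R gs_vec b j)"
      by (simp add: U_def)
    finally show ?thesis using gs_vec_decomp[of b i] by simp
  qed
  then have "Determinant.det (gram_matrix n b) = (Determinant.det ?A)\<^sup>2 * Determinant.det ?D"
    by (rule det_gram_matrix_transform)
  also have "Determinant.det ?A = prod_list (diag_mat ?A)"
    by (rule det_lower_triangular[of n]) (auto simp: U_def)
  also have "diag_mat ?A = map (\<lambda>_. 1) [0..<n]"
    by (auto simp: diag_mat_def U_def)
  also have "prod_list (map (\<lambda>_. 1) [0..<n]) = (1 :: real)"
    by (induction n) auto
  also have "Determinant.det ?D = prod_list (diag_mat ?D)"
    by (rule det_lower_triangular[of n]) (auto simp: gram_matrix_def gs_vec_orthogonal)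
  also have "diag_mat ?D = map (\<lambda>i. (norm (gs_vec b (Suc i)))\<^sup>2) [0..<n]"
    by (auto simp: diag_mat_def gram_matrix_def power2_norm_eq_inner)
  also have "prod_list \<dots> = (\<Prod>i = 1..n. (norm (gs_vec b i))\<^sup>2)"
    by (induction n) (auto simp: prod.nat_ivl_Suc' mult_ac)
  finally show ?thesis by simp
qed

lemma det_gram_matrix_pos:
  assumes "lin_indep_family n b"
  shows "Determinant.det (gram_matrix n b) > 0"
  unfolding det_gram_matrix using gs_vec_nonzero[OF assms] by (intro prod_pos) auto

text \<open>The transition matrix of a sublattice of full rank is integral, so that its determinant,
  which does not vanish, is at least \<open>1\<close> in absolute value.\<close>

lemma det_gram_matrix_le_sublattice:
  assumes e: "lin_indep_family n e"
    and sub: "\<And>i. i \<in> {1..n} \<Longrightarrow> e i \<in> generated_lattice n b"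
  shows "Determinant.det (gram_matrix n b) \<le> Determinant.det (gram_matrix n e)"
proof -
  have "\<exists>c :: nat \<Rightarrow> int. e i = (\<Sum>j = 1..n. of_int (c j) *\<^sub>R b j)" if "i \<in> {1..n}" for i
    using sub[OF that] unfolding generated_lattice_def by blast
  then obtain U :: "nat \<Rightarrow> nat \<Rightarrow> int"
    where U: "\<And>i. i \<in> {1..n} \<Longrightarrow> e i = (\<Sum>j = 1..n. of_int (U i j) *\<^sub>R b j)"
    by metis
  let ?V = "Matrix.mat n n (\<lambda>(i, j). U (Suc i) (Suc j))"
  have map: "Matrix.mat n n (\<lambda>(i, j). real_of_int (U (Suc i) (Suc j))) = map_mat of_int ?V"
    by auto
  have eq: "Determinant.det (gram_matrix n e) =
      (of_int (Determinant.det ?V))\<^sup>2 * Determinant.det (gram_matrix n b)"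
    using det_gram_matrix_transform[of n e "\<lambda>i j. of_int (U i j)" b, OF U]
    unfolding map of_int_hom.hom_det .
  have "Determinant.det ?V \<noteq> 0"
    using eq det_gram_matrix_pos[OF e] by auto
  then have "1 \<le> (Determinant.det ?V)\<^sup>2"
    by (simp add: int_one_le_iff_zero_less)
  then have "1 \<le> (real_of_int (Determinant.det ?V))\<^sup>2"
    by (metis of_int_1 of_int_le_iff of_int_power)
  moreover have "0 \<le> Determinant.det (gram_matrix n b)"
    unfolding det_gram_matrix by (intro prod_nonneg) auto
  ultimately show ?thesis
    unfolding eq using mult_right_mono by fastforce
qed

lemma lattice_det_eq_det_gram_matrix:
  assumes b: "lin_indep_family n b"
  shows "lattice_det (generated_lattice n b) = sqrt (Determinant.det (gram_matrix n b))"
  unfolding lattice_det_def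
proof (rule the_equality)
  show "\<exists>n' b'. lattice_basis n' b' (generated_lattice n b) \<and>
      sqrt (Determinant.det (gram_matrix n b)) = sqrt (Determinant.det (gram_matrix n' b'))"
    using b unfolding lattice_basis_def by blast
next
  fix D
  assume "\<exists>n' b'. lattice_basis n' b' (generated_lattice n b) \<and>
      D = sqrt (Determinant.det (gram_matrix n' b'))"
  then obtain n' b' where b': "lin_indep_family n' b'"
    and L: "generated_lattice n b = generated_lattice n' b'"
    and D: "D = sqrt (Determinant.det (gram_matrix n' b'))"
    unfolding lattice_basis_def by blast
  have n': "n' = n"
    using dim_generated_lattice[OF b] dim_generated_lattice[OF b'] L by simp
  have "Determinant.det (gram_matrix n b) = Determinant.det (gram_matrix n' b')"
    using b b' generated_lattice_base[of _ n b] generated_lattice_base[of _ n b'] L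
    unfolding n' by (intro antisym det_gram_matrix_le_sublattice) auto
  then show "D = sqrt (Determinant.det (gram_matrix n b))" using D by simp
qed

lemma lattice_det_eq_prod_gs:
  assumes "lin_indep_family n b"
  shows "lattice_det (generated_lattice n b) = (\<Prod>i = 1..n. norm (gs_vec b i))"
proof -
  have "lattice_det (generated_lattice n b) = sqrt ((\<Prod>i = 1..n. norm (gs_vec b i))\<^sup>2)"
    unfolding lattice_det_eq_det_gram_matrix[OF assms] det_gram_matrix prod_power_distrib ..
  also have "\<dots> = (\<Prod>i = 1..n. norm (gs_vec b i))"
    by (intro real_sqrt_unique) (auto intro: prod_nonneg)
  finally show ?thesis .
qed

section \<open>Sublattice determinants dominate products of Gram--Schmidt norms\<close>

lemma generated_lattice_eqI:
  assumes "\<And>i. i \<in> {1..k} \<Longrightarrow> e i \<in> generated_lattice k d"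
    and "\<And>i. i \<in> {1..k} \<Longrightarrow> d i \<in> generated_lattice k e"
  shows "generated_lattice k e = generated_lattice k d"
  using assms by (intro antisym generated_lattice_subset)

text \<open>This is Euclid's algorithm on the values \<open>f (d i)\<close>, or the computation of one column of a
  Hermite normal form: as long as two values are nonzero, subtracting or adding the vector with
  the smaller one decreases the sum of the absolute values.\<close>

lemma exists_basis_concentrating_functional:
  fixes f :: "real ^ 'm \<Rightarrow> real" and d :: "nat \<Rightarrow> real ^ 'm" and a :: "nat \<Rightarrow> int"
  assumes "linear f" and "\<And>i. i \<in> {1..k} \<Longrightarrow> f (d i) = of_int (a i)"
  shows "\<exists>e. generated_lattice k e = generated_lattice k d \<and> (\<forall>i\<in>{1..<k}. f (e i) = 0)"
  using assms(2)
proof (induction "\<Sum>i = 1..k. nat \<bar>a i\<bar>" arbitrary: d a rule: less_induct)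
  case less
  note fd = less.prems
  show ?case
  proof (cases "\<exists>i\<in>{1..k}. \<exists>j\<in>{1..k}. i \<noteq> j \<and> a i \<noteq> 0 \<and> a j \<noteq> 0")
    case True
    then obtain i j where ij: "i \<in> {1..k}" "j \<in> {1..k}" "i \<noteq> j" "a j \<noteq> 0" "\<bar>a j\<bar> \<le> \<bar>a i\<bar>"
      by (metis linear)
    \<comment> \<open>The sign that moves \<open>a i\<close> towards \<open>0\<close>.\<close>
    define s where "s = sgn (a i) * sgn (a j)"
    define d' where "d' = d(i := d i - of_int s *\<^sub>R d j)"
    define a' where "a' = a(i := a i - s * a j)"
    have smaller: "\<bar>a i - s * a j\<bar> < \<bar>a i\<bar>"
      using ij(4,5) unfolding s_def sgn_if by (auto split: if_splits)
    have "(\<Sum>l = 1..k. nat \<bar>a' l\<bar>) < (\<Sum>l = 1..k. nat \<bar>a l\<bar>)"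
    proof (rule sum_strict_mono_ex1)
      show "\<forall>l\<in>{1..k}. nat \<bar>a' l\<bar> \<le> nat \<bar>a l\<bar>" using smaller by (auto simp: a'_def)
      show "\<exists>l\<in>{1..k}. nat \<bar>a' l\<bar> < nat \<bar>a l\<bar>"
        using smaller ij(1) by (intro bexI[of _ i]) (simp_all add: a'_def)
    qed simp
    moreover have "f (d' l) = of_int (a' l)" if "l \<in> {1..k}" for l
      using fd[OF that] fd[OF ij(2)] assms(1)
      by (auto simp: d'_def a'_def linear_diff linear_scale)
    ultimately obtain e where e: "generated_lattice k e = generated_lattice k d'"
        "\<forall>i\<in>{1..<k}. f (e i) = 0"
      using less.hyps[of a' d'] by blast
    have base: "d l \<in> generated_lattice k d" "d' l \<in> generated_lattice k d'" if "l \<in> {1..k}" for l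
      using that by (auto intro: generated_lattice_base)
    have "generated_lattice k d' = generated_lattice k d"
    proof (rule generated_lattice_eqI)
      fix l assume l: "l \<in> {1..k}"
      have "d i + of_int (- s) *\<^sub>R d j \<in> generated_lattice k d"
        using base(1) ij by (intro generated_lattice_add generated_lattice_scale) simp_all
      then show "d' l \<in> generated_lattice k d"
        using base(1)[OF l] by (simp add: d'_def)
      have "d' i + of_int s *\<^sub>R d' j \<in> generated_lattice k d'"
        using base(2) ij by (intro generated_lattice_add generated_lattice_scale) simp_all
      moreover have "d' i + of_int s *\<^sub>R d' j = d i"
        using ij(3) by (simp add: d'_def)
      ultimately have "d i \<in> generated_lattice k d'"
        by simp
      then show "d l \<in> generated_lattice k d'"
        using base(2)[OF l] by (cases "l = i") (simp_all add: d'_def)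
    qed
    then show ?thesis using e by auto
  next
    case False
    show ?thesis
    proof (cases "\<exists>i\<in>{1..<k}. a i \<noteq> 0")
      case True
      then obtain i where i: "i \<in> {1..<k}" "a i \<noteq> 0" by blast
      have zero: "f (d l) = 0" if "l \<in> {1..k}" "l \<noteq> i" for l
      proof -
        have "a l = 0" using False that i by (metis atLeastAtMost_iff atLeastLessThan_iff less_imp_le)
        then show ?thesis using fd[OF that(1)] by simp
      qed
      \<comment> \<open>Only \<open>d i\<close> has a nonzero value; it must become the last vector.\<close>
      define e where "e = d(i := d k, k := d i)"
      have base: "d l \<in> generated_lattice k d" "e l \<in> generated_lattice k e" if "l \<in> {1..k}" for l
        using that by (auto intro: generated_lattice_base)
      have "generated_lattice k e = generated_lattice k d"
      proof (rule generated_lattice_eqI)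
        fix l assume l: "l \<in> {1..k}"
        show "e l \<in> generated_lattice k d"
          using base(1)[OF l] base(1)[of i] base(1)[of k] i(1) by (simp add: e_def)
        have "d l = (if l = i then e k else if l = k then e i else e l)"
          using i(1) by (simp add: e_def)
        then show "d l \<in> generated_lattice k e"
          using base(2)[OF l] base(2)[of i] base(2)[of k] i(1) by simp
      qed
      moreover have "\<forall>l\<in>{1..<k}. f (e l) = 0"
        using zero i(1) by (simp add: e_def)
      ultimately show ?thesis by blast
    next
      case False
      then have "\<forall>i\<in>{1..<k}. f (d i) = 0" using fd by simp
      then show ?thesis by blast
    qed
  qed
qed

lemma inner_gs_vec_gt:
  assumes "1 \<le> i" "i < j"
  shows "inner (b i) (gs_vec b j) = 0"
proof -
  have "inner (b i) (gs_vec b j) = inner (gs_vec b i) (gs_vec b j)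
      + (\<Sum>l = 1..<i. gs_coeff b i l * inner (gs_vec b l) (gs_vec b j))"
    by (subst gs_vec_decomp[of b i]) (simp add: inner_add_left inner_sum_left)
  also have "\<dots> = 0" using assms by (simp add: gs_vec_orthogonal)
  finally show ?thesis .
qed

lemma inner_gs_vec_same:
  assumes "1 \<le> j"
  shows "inner (b j) (gs_vec b j) = (norm (gs_vec b j))\<^sup>2"
proof -
  have "inner (b j) (gs_vec b j) = inner (gs_vec b j) (gs_vec b j)
      + (\<Sum>l = 1..<j. gs_coeff b j l * inner (gs_vec b l) (gs_vec b j))"
    by (subst gs_vec_decomp[of b j]) (simp add: inner_add_left inner_sum_left)
  also have "(\<Sum>l = 1..<j. gs_coeff b j l * inner (gs_vec b l) (gs_vec b j)) = 0"
    by (intro sum.neutral) (simp add: gs_vec_orthogonal)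
  finally show ?thesis by (simp add: power2_norm_eq_inner)
qed

lemma inner_combination_last_gs_vec:
  "inner (\<Sum>i = 1..Suc n. c i *\<^sub>R b i) (gs_vec b (Suc n)) = c (Suc n) * (norm (gs_vec b (Suc n)))\<^sup>2"
  by (simp add: inner_add_left inner_sum_left inner_gs_vec_gt inner_gs_vec_same)

text \<open>The first \<open>k - 1\<close> vectors are orthogonal to \<open>g\<close>, so orthogonalising the last one against
  them does not change its inner product with \<open>g\<close>.\<close>

lemma inner_gs_vec_of_orthogonal:
  assumes "\<And>i. i \<in> {1..<k} \<Longrightarrow> inner (e i) g = 0"
  shows "inner (gs_vec e k) g = inner (e k) g"
proof -
  have "real_inner_class.orthogonal g y" if "y \<in> e ` {1..<k}" for y
    using that assms by (auto simp: real_inner_class.orthogonal_def inner_commute[of g])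
  then have "real_inner_class.orthogonal g (gs_vec e j)" if "j \<in> {1..<k}" for j
    using orthogonal_to_span[OF gs_vec_in_span_less[OF that, of e]] by blast
  then have "inner (gs_vec e j) g = 0" if "j \<in> {1..<k}" for j
    using that by (simp add: real_inner_class.orthogonal_def inner_commute[of _ g])
  then have "inner (\<Sum>j = 1..<k. gs_coeff e k j *\<^sub>R gs_vec e j) g = 0"
    by (simp add: inner_sum_left)
  then show ?thesis
    by (subst (2) gs_vec_decomp) (simp add: inner_add_left)
qed

text \<open>Choose the basis of the sublattice so that at most its last member uses \<open>b\<^sub>n\<close>. If that
  member does, its coefficient there is a nonzero integer, so its component orthogonal to
  \<open>b\<^sub>1, \<dots>, b\<^bsub>n - 1\<^esub>\<close> is at least as long as \<open>b\<^sub>n\<^sup>*\<close>. Its Gram--Schmidt vector is at least as long as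
  that component, because the remaining members lie in the span of \<open>b\<^sub>1, \<dots>, b\<^bsub>n - 1\<^esub>\<close>; the index
  \<open>n\<close> is then added to the set found for the remaining members.\<close>

lemma exists_gs_vec_prod_le_lattice_det:
  fixes b d :: "nat \<Rightarrow> real ^ 'm"
  assumes "lin_indep_family n b" "lin_indep_family k d"
    and "\<And>i. i \<in> {1..k} \<Longrightarrow> d i \<in> generated_lattice n b"
  shows "\<exists>I\<subseteq>{1..n}. card I = k \<and> (\<Prod>i\<in>I. norm (gs_vec b i)) \<le> lattice_det (generated_lattice k d)"
  using assms
proof (induction n arbitrary: k d)
  case 0
  have "generated_lattice k d \<subseteq> generated_lattice 0 b"
    using 0 by (intro generated_lattice_subset)
  then have "k \<le> 0"
    using dim_subset dim_generated_lattice[OF 0(1)] dim_generated_lattice[OF 0(2)] by metis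
  then show ?case
    using lattice_det_eq_prod_gs[OF 0(2)] by auto
next
  case (Suc n)
  note b = Suc.prems(1) and d = Suc.prems(2) and dL = Suc.prems(3)
  define g where "g = gs_vec b (Suc n)"
  have g: "g \<noteq> 0" unfolding g_def using b by (rule gs_vec_nonzero) simp
  have "\<exists>c :: int. inner x g = of_int c * (norm g)\<^sup>2 \<and> (c = 0 \<longrightarrow> x \<in> generated_lattice n b)"
    if x: "x \<in> generated_lattice (Suc n) b" for x
  proof -
    obtain c where c: "x = (\<Sum>i = 1..Suc n. of_int (c i) *\<^sub>R b i)"
      using x by (rule generated_latticeE)
    have "inner x g = c (Suc n) * (norm g)\<^sup>2"
      unfolding c g_def by (rule inner_combination_last_gs_vec)
    moreover have "x \<in> generated_lattice n b" if "c (Suc n) = 0"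
      using that generated_latticeI[of c b n] unfolding c by simp
    ultimately show ?thesis by blast
  qed
  then obtain c :: "real ^ 'm \<Rightarrow> int"
    where c: "\<And>x. x \<in> generated_lattice (Suc n) b \<Longrightarrow> inner x g = of_int (c x) * (norm g)\<^sup>2"
      and c0: "\<And>x. x \<in> generated_lattice (Suc n) b \<Longrightarrow> c x = 0 \<Longrightarrow> x \<in> generated_lattice n b"
    by metis
  have "linear (\<lambda>x. inner x g / (norm g)\<^sup>2)"
    by (intro linearI) (simp_all add: inner_add_left add_divide_distrib)
  moreover have "inner (d i) g / (norm g)\<^sup>2 = c (d i)" if "i \<in> {1..k}" for i
    using c[OF dL[OF that]] g by simp
  ultimately obtain e where ed: "generated_lattice k e = generated_lattice k d"
    and e0: "\<forall>i\<in>{1..<k}. inner (e i) g / (norm g)\<^sup>2 = 0"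
    using exists_basis_concentrating_functional[of "\<lambda>x. inner x g / (norm g)\<^sup>2" k d "\<lambda>i. c (d i)"]
    by blast
  have e: "lin_indep_family k e" using lin_indep_family_cong_lattice d ed by blast
  have eL: "e i \<in> generated_lattice (Suc n) b" if "i \<in> {1..k}" for i
    using generated_lattice_base[OF that, of e] generated_lattice_subset[of k d "Suc n" b, OF dL]
    unfolding ed by blast
  have orth: "inner (e i) g = 0" if "i \<in> {1..<k}" for i
    using e0 that g by simp
  have eLn: "e i \<in> generated_lattice n b" if "i \<in> {1..<k}" for i
    using c0[OF eL, of i] c[OF eL, of i] orth[OF that] g that by simp
  have bn: "lin_indep_family n b" using lin_indep_family_mono[OF b] by simp
  show ?case
  proof (cases "k = 0 \<or> c (e k) = 0")
    case True
    have "e i \<in> generated_lattice n b" if "i \<in> {1..k}" for i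
      using that True eLn[of i] c0[OF eL, of k] by (cases "i = k") auto
    then obtain I where "I \<subseteq> {1..n}" "card I = k"
        "(\<Prod>i\<in>I. norm (gs_vec b i)) \<le> lattice_det (generated_lattice k e)"
      using Suc.IH[OF bn e] by blast
    moreover from this have "I \<subseteq> {1..Suc n}" by auto
    ultimately show ?thesis unfolding ed by blast
  next
    case False
    then obtain k' where k: "k = Suc k'" by (cases k) auto
    have e': "lin_indep_family k' e" using lin_indep_family_mono[OF e] k by simp
    obtain I where I: "I \<subseteq> {1..n}" "card I = k'"
        "(\<Prod>i\<in>I. norm (gs_vec b i)) \<le> lattice_det (generated_lattice k' e)"
      using Suc.IH[OF bn e'] eLn k by auto
    have fin: "finite I" and notin: "Suc n \<notin> I"
      using I(1) finite_subset by auto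
    have "1 \<le> \<bar>real_of_int (c (e k))\<bar>"
      using False by linarith
    then have "norm g * norm g \<le> \<bar>of_int (c (e k)) * (norm g)\<^sup>2\<bar>"
      by (simp add: abs_mult power2_eq_square mult_le_cancel_right1)
    also have "\<dots> = \<bar>inner (gs_vec e k) g\<bar>"
      using inner_gs_vec_of_orthogonal[of k e g, OF orth] c[OF eL, of k] k by simp
    also have "\<dots> \<le> norm (gs_vec e k) * norm g"
      by (rule Cauchy_Schwarz_ineq2)
    finally have "norm g \<le> norm (gs_vec e k)"
      using g by simp
    then have "norm g * (\<Prod>i\<in>I. norm (gs_vec b i)) \<le> norm (gs_vec e k) * lattice_det (generated_lattice k' e)"
      using I(3) by (intro mult_mono) (auto intro: prod_nonneg)
    also have "\<dots> = lattice_det (generated_lattice k e)"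
      unfolding lattice_det_eq_prod_gs[OF e] lattice_det_eq_prod_gs[OF e'] by (simp add: k)
    finally have "(\<Prod>i\<in>insert (Suc n) I. norm (gs_vec b i)) \<le> lattice_det (generated_lattice k d)"
      using fin notin by (simp add: g_def ed)
    moreover have "insert (Suc n) I \<subseteq> {1..Suc n}" "card (insert (Suc n) I) = k"
      using I fin notin k by auto
    ultimately show ?thesis by blast
  qed
qed

section \<open>Partial sums of nondecreasing sequences\<close>

text \<open>Outside the common part \<open>{1..k} \<inter> I\<close> both index sets have the same number of elements, and
  \<open>y k\<close> separates the terms of the one from those of the other.\<close>

lemma sum_initial_le_sum_subset:
  fixes y :: "nat \<Rightarrow> real"
  assumes y: "\<And>i j. 1 \<le> i \<Longrightarrow> i \<le> j \<Longrightarrow> j \<le> n \<Longrightarrow> y i \<le> y j"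
    and I: "I \<subseteq> {1..n}" "card I = k"
  shows "sum y {1..k} \<le> sum y I"
proof (cases "k = 0")
  case True
  then show ?thesis using I finite_subset[OF I(1)] by simp
next
  case False
  have fin: "finite I" using I(1) finite_subset by blast
  have kn: "k \<le> n" using card_mono[OF _ I(1)] I(2) by simp
  have "card ({1..k} - I) = card (I - {1..k})"
    using card_Diff_subset_Int[of "{1..k}" I] card_Diff_subset_Int[of I "{1..k}"] fin I(2)
    by (simp add: Int_commute)
  moreover have "sum y ({1..k} - I) \<le> of_nat (card ({1..k} - I)) * y k"
    using kn by (intro sum_bounded_above y) auto
  moreover have "of_nat (card (I - {1..k})) * y k \<le> sum y (I - {1..k})"
    using I(1) False by (intro sum_bounded_below y) auto
  ultimately have "sum y ({1..k} - I) \<le> sum y (I - {1..k})"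
    by simp
  moreover have "sum y {1..k} = sum y ({1..k} - I) + sum y ({1..k} \<inter> I)"
    by (subst sum.union_disjoint[symmetric]) (auto intro!: sum.cong)
  moreover have "sum y I = sum y (I - {1..k}) + sum y ({1..k} \<inter> I)"
    using fin by (subst sum.union_disjoint[symmetric]) (auto intro!: sum.cong)
  ultimately show ?thesis by simp
qed

lemma sum_real_initial: "(\<Sum>i = 1..k. real i) = real k * (real k + 1) / 2"
  by (induction k) (auto simp: field_simps)

text \<open>The sum over \<open>I\<close> is largest when the one over the complement is smallest, that is, when the
  complement is \<open>{1..n - k}\<close>.\<close>

lemma sum_real_subset_le:
  assumes "I \<subseteq> {1..n}" "card I = k" "k \<le> n"
  shows "(\<Sum>i\<in>I. real i) \<le> real k * (real k + 1) / 2 + real k * (real n - real k)"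
proof -
  have fin: "finite I" using assms(1) finite_subset by blast
  have "card ({1..n} - I) = n - k"
    using assms fin by (simp add: card_Diff_subset)
  then have "(\<Sum>i = 1..n - k. real i) \<le> (\<Sum>i\<in>{1..n} - I. real i)"
    by (intro sum_initial_le_sum_subset[where n = n]) auto
  also have "\<dots> = (\<Sum>i = 1..n. real i) - (\<Sum>i\<in>I. real i)"
    using assms(1) by (intro sum_diff) auto
  finally show ?thesis
    unfolding sum_real_initial using assms(3) by (simp add: field_simps)
qed

text \<open>The first \<open>k\<close> terms have an average of at most \<open>y k\<close>, and the others one of at least \<open>y k\<close>.\<close>

lemma average_initial_le_average:
  fixes y :: "nat \<Rightarrow> real"
  assumes y: "\<And>i j. 1 \<le> i \<Longrightarrow> i \<le> j \<Longrightarrow> j \<le> n \<Longrightarrow> y i \<le> y j"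
    and k: "1 \<le> k" "k \<le> n"
  shows "real n * sum y {1..k} \<le> real k * sum y {1..n}"
proof -
  have "sum y {1..k} \<le> of_nat (card {1..k}) * y k"
    using k by (intro sum_bounded_above y) auto
  then have 1: "sum y {1..k} \<le> real k * y k" by simp
  have "of_nat (card {k<..n}) * y k \<le> sum y {k<..n}"
    using k by (intro sum_bounded_below y) auto
  then have 2: "(real n - real k) * y k \<le> sum y {k<..n}" using k by simp
  have 3: "sum y {1..n} = sum y {1..k} + sum y {k<..n}"
    using k by (subst sum.union_disjoint[symmetric]) (auto intro!: sum.cong)
  have "(real n - real k) * sum y {1..k} \<le> real k * ((real n - real k) * y k)"
    using mult_left_mono[OF 1, of "real n - real k"] k by (simp add: mult_ac)
  also have "\<dots> \<le> real k * sum y {k<..n}"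
    using 2 by (intro mult_left_mono) auto
  finally show ?thesis unfolding 3 by (simp add: algebra_simps)
qed

section \<open>Gram--Schmidt norms of an LLL-reduced basis\<close>

text \<open>The swap condition reads \<open>3/4 - \<mu>\<^sup>2 \<le> \<parallel>b\<^sub>j\<^sup>*\<parallel>\<^sup>2 / \<parallel>b\<^bsub>j - 1\<^esub>\<^sup>*\<parallel>\<^sup>2\<close>, and size reduction makes the
  left-hand side at least \<open>1/2\<close>.\<close>

lemma LLL_reduced_gs_vec_step:
  assumes "LLL_reduced n b" "j \<in> {2..n}"
  shows "(norm (gs_vec b (j - 1)))\<^sup>2 \<le> 2 * (norm (gs_vec b j))\<^sup>2"
proof -
  define g where "g = gs_vec b (j - 1)"
  define m where "m = gs_coeff b j (j - 1)"
  have m: "\<bar>m\<bar> \<le> 1 / 2"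
    using assms unfolding LLL_reduced_def m_def by auto
  then have "m\<^sup>2 \<le> (1 / 2)\<^sup>2"
    using abs_le_square_iff[of m "1 / 2"] by simp
  then have "m\<^sup>2 * (norm g)\<^sup>2 \<le> 1 / 4 * (norm g)\<^sup>2"
    by (intro mult_right_mono) (simp_all add: power2_eq_square)
  moreover have "3 / 4 * (norm g)\<^sup>2 \<le> (norm (gs_vec b j + m *\<^sub>R g))\<^sup>2"
    using assms unfolding LLL_reduced_def g_def m_def by auto
  moreover have "inner (gs_vec b j) g = 0"
    unfolding g_def using assms(2) by (intro gs_vec_orthogonal) auto
  then have "(norm (gs_vec b j + m *\<^sub>R g))\<^sup>2 = (norm (gs_vec b j))\<^sup>2 + m\<^sup>2 * (norm g)\<^sup>2"
    unfolding power2_norm_eq_inner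
    by (simp add: inner_add_left inner_add_right inner_commute[of g "gs_vec b j"] power2_eq_square)
  ultimately show ?thesis unfolding g_def by simp
qed

lemma LLL_reduced_gs_vec_le:
  assumes b: "LLL_reduced n b" and "1 \<le> i" "i \<le> j" "j \<le> n"
  shows "(norm (gs_vec b i))\<^sup>2 \<le> 2 ^ (j - i) * (norm (gs_vec b j))\<^sup>2"
  using assms(3,4)
proof (induction j rule: dec_induct)
  case base
  then show ?case by simp
next
  case (step j)
  have "(norm (gs_vec b i))\<^sup>2 \<le> 2 ^ (j - i) * (norm (gs_vec b j))\<^sup>2"
    using step by simp
  also have "\<dots> \<le> 2 ^ (j - i) * (2 * (norm (gs_vec b (Suc j)))\<^sup>2)"
    using LLL_reduced_gs_vec_step[OF b, of "Suc j"] step assms(2) by (intro mult_left_mono) auto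
  also have "\<dots> = 2 ^ (Suc j - i) * (norm (gs_vec b (Suc j)))\<^sup>2"
    using step by (simp add: Suc_diff_le)
  finally show ?case .
qed

lemma norm_gs_vec_decomp:
  assumes "1 \<le> i"
  shows "(norm (b i))\<^sup>2 = (norm (gs_vec b i))\<^sup>2
    + (\<Sum>j = 1..<i. (gs_coeff b i j)\<^sup>2 * (norm (gs_vec b j))\<^sup>2)"
proof -
  define s where "s = (\<Sum>j = 1..<i. gs_coeff b i j *\<^sub>R gs_vec b j)"
  have 1: "inner (gs_vec b i) s = 0"
    unfolding s_def inner_sum_right using assms
    by (intro sum.neutral) (auto simp: gs_vec_orthogonal)
  have "inner s s = (\<Sum>j = 1..<i. norm (gs_coeff b i j *\<^sub>R gs_vec b j) ^ 2)"
    unfolding s_def power2_norm_eq_inner[symmetric]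
    by (intro norm_sum_Pythagorean)
      (auto simp: pairwise_def real_inner_class.orthogonal_def gs_vec_orthogonal)
  then have 2: "inner s s = (\<Sum>j = 1..<i. (gs_coeff b i j)\<^sup>2 * (norm (gs_vec b j))\<^sup>2)"
    by (simp add: power_mult_distrib)
  have "b i = gs_vec b i + s"
    unfolding s_def by (rule gs_vec_decomp)
  then have "inner (b i) (b i) = inner (gs_vec b i) (gs_vec b i) + inner s s"
    using 1 by (simp add: inner_add_left inner_add_right inner_commute)
  then show ?thesis unfolding 2 by (simp add: power2_norm_eq_inner)
qed

lemma sum_pow2_diff: "(\<Sum>j = 1..<i. 2 ^ (i - j)) \<le> (2 ^ i - 2 :: real)" if "1 \<le> i"
  using that
proof (induction i rule: dec_induct)
  case (step i)
  have "(\<Sum>j = 1..<Suc i. 2 ^ (Suc i - j)) = (2 :: real) + (\<Sum>j = 1..<i. 2 * 2 ^ (i - j))"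
    using step by (simp add: Suc_diff_le)
  also have "\<dots> = 2 + 2 * (\<Sum>j = 1..<i. 2 ^ (i - j))"
    by (simp add: sum_distrib_left)
  finally show ?case using step by simp
qed simp

text \<open>Size reduction bounds the correction by \<open>1/4 \<Sum>\<^bsub>j < i\<^esub> 2\<^bsup>i - j\<^esup> = (2\<^sup>i - 2) / 4\<close> times
  \<open>\<parallel>b\<^sub>i\<^sup>*\<parallel>\<^sup>2\<close>.\<close>

lemma LLL_reduced_norm_le_gs_vec:
  assumes b: "LLL_reduced n b" and i: "1 \<le> i" "i \<le> n"
  shows "(norm (b i))\<^sup>2 \<le> 2 ^ (i - 1) * (norm (gs_vec b i))\<^sup>2"
proof -
  let ?N = "(norm (gs_vec b i))\<^sup>2"
  have le: "(gs_coeff b i j)\<^sup>2 * (norm (gs_vec b j))\<^sup>2 \<le> 1 / 4 * (2 ^ (i - j) * ?N)"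
    if "j \<in> {1..<i}" for j
  proof (rule mult_mono)
    have "\<bar>gs_coeff b i j\<bar> \<le> 1 / 2"
      using b that i unfolding LLL_reduced_def by auto
    then have "(gs_coeff b i j)\<^sup>2 \<le> (1 / 2)\<^sup>2"
      using abs_le_square_iff[of "gs_coeff b i j" "1 / 2"] by simp
    then show "(gs_coeff b i j)\<^sup>2 \<le> 1 / 4" by (simp add: power2_eq_square)
    show "(norm (gs_vec b j))\<^sup>2 \<le> 2 ^ (i - j) * ?N"
      using that i by (intro LLL_reduced_gs_vec_le[OF b]) simp_all
  qed simp_all
  have "(norm (b i))\<^sup>2 \<le> ?N + (\<Sum>j = 1..<i. 1 / 4 * (2 ^ (i - j) * ?N))"
    unfolding norm_gs_vec_decomp[of i b, OF i(1)] by (intro add_left_mono sum_mono le)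
  also have "\<dots> = ?N + 1 / 4 * (\<Sum>j = 1..<i. 2 ^ (i - j)) * ?N"
    by (simp only: sum_distrib_left sum_distrib_right mult.assoc)
  also have "\<dots> \<le> ?N + 1 / 4 * (2 ^ i - 2) * ?N"
    using sum_pow2_diff[OF i(1)] by (intro add_left_mono mult_right_mono mult_left_mono) auto
  also have "\<dots> = (1 / 2 + 2 ^ i / 4) * ?N"
    by (simp add: algebra_simps)
  also have "\<dots> \<le> 2 ^ (i - 1) * ?N"
  proof (intro mult_right_mono)
    have "(2 :: real) ^ i = 2 * 2 ^ (i - 1)"
      using i(1) by (cases i) auto
    moreover have "(1 :: real) \<le> 2 ^ (i - 1)" by simp
    ultimately show "(1 / 2 + 2 ^ i / 4 :: real) \<le> 2 ^ (i - 1)" by linarith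
  qed simp
  finally show ?thesis .
qed

section \<open>The bounds\<close>

text \<open>The logarithmic form of the growth bound: up to the drift \<open>i / 2\<close>, the logarithms of the
  Gram--Schmidt norms are nondecreasing.\<close>

lemma LLL_reduced_log_gs_vec_mono:
  assumes b: "lin_indep_family n b" "LLL_reduced n b" and ij: "1 \<le> i" "i \<le> j" "j \<le> n"
  shows "log 2 (norm (gs_vec b i)) + real i / 2 \<le> log 2 (norm (gs_vec b j)) + real j / 2"
proof -
  have pos: "0 < norm (gs_vec b i)" "0 < norm (gs_vec b j)"
    using gs_vec_nonzero[OF b(1)] ij by auto
  have "log 2 ((norm (gs_vec b i))\<^sup>2) \<le> log 2 (2 ^ (j - i) * (norm (gs_vec b j))\<^sup>2)"
    using LLL_reduced_gs_vec_le[OF b(2) ij] pos by (intro log_mono) auto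
  also have "\<dots> = real (j - i) + 2 * log 2 (norm (gs_vec b j))"
    using pos by (simp add: log_mult log_nat_power)
  finally show ?thesis
    using pos ij by (simp add: log_nat_power)
qed

theorem theorem1:
  fixes b d :: "nat \<Rightarrow> real ^ 'm" and n k :: nat and L :: "(real ^ 'm) set"
  assumes "lattice_basis n b L" and "LLL_reduced n b"
    and "1 \<le> k" and "k \<le> n"
    and "lin_indep_family k d" and "\<forall>i\<in>{1..k}. d i \<in> L"
  shows "norm (b 1) \<le> 2 powr ((real n - real k) / 2 + (real k - 1) / 4)
           * lattice_det (generated_lattice k d) powr (1 / real k)
    \<and> lattice_det (generated_lattice k b) \<le> 2 powr (real k * (real n - real k) / 2)
           * lattice_det (generated_lattice k d)
    \<and> lattice_det (generated_lattice k b) \<le> 2 powr (real k * (real n - real k) / 4)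
           * lattice_det L powr (real k / real n)
    \<and> (\<Prod>i = 1..k. norm (b i)) \<le> 2 powr (real k * (real n - real k) / 2 + real k * (real k - 1) / 4)
           * lattice_det (generated_lattice k d)
    \<and> (\<Prod>i = 1..k. norm (b i)) \<le> 2 powr (real k * (real n - 1) / 4)
           * lattice_det L powr (real k / real n)"
proof -
  have indb: "lin_indep_family n b" and L: "L = generated_lattice n b"
    using assms(1) by (auto simp: lattice_basis_def)
  have indbk: "lin_indep_family k b" using lin_indep_family_mono[OF indb assms(4)] .
  have k: "real k > 0" and n: "real n > 0" using assms(3,4) by auto
  define x where "x i = log 2 (norm (gs_vec b i))" for i
  define y where "y i = x i + real i / 2" for i
  have norm_gs: "norm (gs_vec b i) = 2 powr x i" if "i \<in> {1..n}" for i
    using gs_vec_nonzero[OF indb that] by (simp add: x_def)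
  have prod_gs: "(\<Prod>i\<in>I. norm (gs_vec b i)) = 2 powr sum x I" if "I \<subseteq> {1..n}" for I
  proof -
    have "(\<Prod>i\<in>I. norm (gs_vec b i)) = (\<Prod>i\<in>I. 2 powr x i)"
      using that by (intro prod.cong refl norm_gs) auto
    then show ?thesis using that finite_subset by (subst powr_sum) auto
  qed
  have y_mono: "y i \<le> y j" if "1 \<le> i" "i \<le> j" "j \<le> n" for i j
    unfolding y_def x_def using LLL_reduced_log_gs_vec_mono[OF indb assms(2) that] .
  have sum_y: "sum y I = sum x I + (\<Sum>i\<in>I. real i) / 2" for I
    by (simp add: y_def sum.distrib sum_divide_distrib)

  \<comment> \<open>In logarithms, \<open>d\<close> enters the bounds only through the sum of \<open>x\<close> over a set \<open>I\<close>.\<close>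
  define D where "D = lattice_det (generated_lattice k d)"
  obtain I where I: "I \<subseteq> {1..n}" "card I = k" and "(\<Prod>i\<in>I. norm (gs_vec b i)) \<le> D"
    using exists_gs_vec_prod_le_lattice_det[OF indb assms(5)] assms(6) unfolding L D_def by blast
  then have D: "2 powr sum x I \<le> D" using prod_gs by simp

  define X where "X = sum x {1..k}"
  have detk: "lattice_det (generated_lattice k b) = 2 powr X"
    unfolding lattice_det_eq_prod_gs[OF indbk] X_def using assms(4) by (intro prod_gs) auto
  have detL: "lattice_det L = 2 powr sum x {1..n}"
    unfolding L lattice_det_eq_prod_gs[OF indb] by (rule prod_gs) simp

  have XI: "X \<le> real k * (real n - real k) / 2 + sum x I"
    using sum_initial_le_sum_subset[of n y, OF y_mono I] sum_real_subset_le[OF I assms(4)]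
    unfolding sum_y sum_real_initial X_def by simp
  have "real n * X \<le> real n * (real k * (real n - real k) / 4) + real k * sum x {1..n}"
    using average_initial_le_average[of n y k, OF y_mono assms(3,4)]
    unfolding sum_y sum_real_initial X_def
    by (simp add: algebra_simps add_divide_distrib diff_divide_distrib)
  then have XL: "X \<le> real k * (real n - real k) / 4 + sum x {1..n} * (real k / real n)"
    using n by (simp add: field_simps)
  \<comment> \<open>For the bound on \<open>b 1\<close>, which is its own Gram--Schmidt vector: \<open>y 1\<close> is the smallest term.\<close>
  have "(\<Sum>i = 1..k. y 1) \<le> sum y {1..k}"
    using assms(4) by (intro sum_mono y_mono) auto
  then have "real k * x 1 \<le> real k * (real k - 1) / 4 + X"
    unfolding sum_y sum_real_initial X_def 
    by (simp add: y_def algebra_simps add_divide_distrib diff_divide_distrib)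
  then have "real k * x 1 \<le> real k * ((real n - real k) / 2 + (real k - 1) / 4) + sum x I"
    using XI by (simp add: algebra_simps add_divide_distrib diff_divide_distrib)
  then have x1: "x 1 \<le> (real n - real k) / 2 + (real k - 1) / 4 + sum x I * (1 / real k)"
    using k by (simp add: field_simps)

  have "norm (b i) \<le> 2 powr ((real i - 1) / 2 + x i)" if "i \<in> {1..k}" for i
  proof (rule power2_le_imp_le)
    have i: "1 \<le> i" "i \<le> n" using that assms(4) by auto
    have sq: "(2 powr u)\<^sup>2 = 2 powr (2 * u)" for u :: real
      unfolding power2_eq_square powr_add[symmetric] by simp
    have pow: "2 ^ (i - 1) = 2 powr (real i - 1)"
      using i(1) powr_realpow[of 2 "i - 1"] by simp
    have "(norm (b i))\<^sup>2 \<le> 2 ^ (i - 1) * (norm (gs_vec b i))\<^sup>2"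
      using LLL_reduced_norm_le_gs_vec[OF assms(2) i] .
    also have "\<dots> = 2 powr (real i - 1) * 2 powr (2 * x i)"
      using i norm_gs[of i] by (simp only: pow sq atLeastAtMost_iff)
    also have "\<dots> = (2 powr ((real i - 1) / 2 + x i))\<^sup>2"
      unfolding sq powr_add[symmetric] by (simp add: algebra_simps diff_divide_distrib)
    finally show "(norm (b i))\<^sup>2 \<le> (2 powr ((real i - 1) / 2 + x i))\<^sup>2" .
  qed simp
  then have "(\<Prod>i = 1..k. norm (b i)) \<le> (\<Prod>i = 1..k. 2 powr ((real i - 1) / 2 + x i))"
    by (intro prod_mono) auto
  also have "\<dots> = 2 powr (\<Sum>i = 1..k. (real i - 1) / 2 + x i)"
    by (simp add: powr_sum)
  also have "(\<Sum>i = 1..k. (real i - 1) / 2 + x i) = ((\<Sum>i = 1..k. real i) - real k) / 2 + X"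
    by (simp add: X_def sum.distrib sum_subtractf sum_divide_distrib[symmetric])
  also have "\<dots> = real k * (real k - 1) / 4 + X"
    unfolding sum_real_initial by (simp add: field_simps)
  finally have P: "(\<Prod>i = 1..k. norm (b i)) \<le> 2 powr (real k * (real k - 1) / 4 + X)" .

  have detL_powr: "lattice_det L powr (real k / real n) = 2 powr (sum x {1..n} * (real k / real n))"
    unfolding detL by (simp add: powr_powr)
  have below_D: "2 powr u \<le> 2 powr v * D" if "u \<le> v + sum x I" for u v
  proof -
    have "2 powr u \<le> 2 powr v * 2 powr sum x I"
      unfolding powr_add[symmetric] using that by simp
    also have "\<dots> \<le> 2 powr v * D" using D by (intro mult_left_mono) auto
    finally show ?thesis .
  qed
  have below_L: "2 powr u \<le> 2 powr v * lattice_det L powr (real k / real n)"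
    if "u \<le> v + sum x {1..n} * (real k / real n)" for u v
    unfolding detL_powr powr_add[symmetric] using that by simp

  have "norm (b 1) = norm (gs_vec b 1)" by (subst gs_vec.simps) simp
  also have "\<dots> = 2 powr x 1" using norm_gs[of 1] assms(3,4) by simp
  also have "\<dots> \<le> 2 powr ((real n - real k) / 2 + (real k - 1) / 4 + sum x I * (1 / real k))"
    using x1 by simp
  also have "\<dots> = 2 powr ((real n - real k) / 2 + (real k - 1) / 4) * (2 powr sum x I) powr (1 / real k)"
    by (simp only: powr_add powr_powr)
  also have "\<dots> \<le> 2 powr ((real n - real k) / 2 + (real k - 1) / 4) * D powr (1 / real k)"
    using D by (intro mult_left_mono powr_mono2) auto
  finally have first: "norm (b 1) \<le> 2 powr ((real n - real k) / 2 + (real k - 1) / 4) * D powr (1 / real k)" .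

  have second: "lattice_det (generated_lattice k b) \<le> 2 powr (real k * (real n - real k) / 2) * D"
    unfolding detk using XI by (rule below_D)
  have third: "lattice_det (generated_lattice k b)
      \<le> 2 powr (real k * (real n - real k) / 4) * lattice_det L powr (real k / real n)"
    unfolding detk using XL by (rule below_L)
  have "real k * (real k - 1) / 4 + X
      \<le> real k * (real n - real k) / 2 + real k * (real k - 1) / 4 + sum x I"
    using XI by simp
  then have fourth: "(\<Prod>i = 1..k. norm (b i))
      \<le> 2 powr (real k * (real n - real k) / 2 + real k * (real k - 1) / 4) * D"
    using P below_D order_trans by blast
  have "real k * (real k - 1) / 4 + X \<le> real k * (real n - 1) / 4 + sum x {1..n} * (real k / real n)"
    using XL by (simp add: algebra_simps add_divide_distrib diff_divide_distrib)
  then have fifth: "(\<Prod>i = 1..k. norm (b i))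
      \<le> 2 powr (real k * (real n - 1) / 4) * lattice_det L powr (real k / real n)"
    using P below_L order_trans by blast
  show ?thesis
    using first second third fourth fifth unfolding D_def by (intro conjI)
qed

end
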